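(* Let $K$ be a field and let $I\subset K[x,y]$ be an equigenerated monomial ideal with $\mu(I)=m$ and $\operatorname{height} I=2$. Then: (a) $\mu(I^k)\geq k(m-1)+1$ for all $k\geq 1$. (b) The following conditions are equivalent: (i) $\mu(I^k)=k(m-1)+1$ for some $k\geq 2$; (ii) $\mu(I^k)=k(m-1)+1$ for all $k\geq 2$; (iii) there exist positive integers $a$ and $r$ such that $I=(x^a,y^a)^r$.
   Context: $\mu(L)$ denotes the minimal number of generators of a monomial ideal $L$. A monomial ideal is equigenerated if it is generated by monomials all of the same degree. *)

theory Defs
  imports
    "HOL-Algebra.Ideal_Product"
    "HOL-Algebra.Algebraic_Closure_Type"
    "HOL-Library.Extended_Nat"
begin

subsection \<open>Powers, numbers of generators and heights of ideals\<close>

abbreviation ideal_pow :: "('a, 'b) ring_scheme \<Rightarrow> 'a set \<Rightarrow> nat \<Rightarrow> 'a set"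
  where "ideal_pow R I k \<equiv> I [^]\<^bsub>ideals_set R\<^esub> k"

text \<open>Generators are arbitrary ring elements, not only monomials.  The value is meaningful
  only for finitely generated ideals.\<close>

definition min_gens :: "('a, 'b) ring_scheme \<Rightarrow> 'a set \<Rightarrow> nat"
  where "min_gens R I =
    (LEAST n. \<exists>S. finite S \<and> card S = n \<and> S \<subseteq> carrier R \<and> I = Idl\<^bsub>R\<^esub> S)"

text \<open>The supremum of the lengths \<open>n\<close> of chains of primes \<open>P\<^sub>0 \<subset> \<dots> \<subset> P\<^sub>n = P\<close>.\<close>

definition prime_height :: "('a, 'b) ring_scheme \<Rightarrow> 'a set \<Rightarrow> enat"
  where "prime_height R P =
    Sup {enat n | n. \<exists>C :: nat \<Rightarrow> 'a set.
           (\<forall>i\<le>n. primeideal (C i) R) \<and> (\<forall>i<n. C i \<subset> C (Suc i)) \<and> C n = P}"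

text \<open>The unit ideal has height \<open>\<infinity>\<close>, being the infimum of the empty set.\<close>

definition ideal_height :: "('a, 'b) ring_scheme \<Rightarrow> 'a set \<Rightarrow> enat"
  where "ideal_height R I = Inf {prime_height R P | P. primeideal P R \<and> I \<subseteq> P}"

subsection \<open>Monomial ideals in \<open>K[x,y]\<close>\<close>

text \<open>\<open>K[x,y]\<close> is the type \<open>'k poly poly\<close>, read as \<open>K[x][y]\<close>:
  the inner variable is \<open>x\<close>, the outer one is \<open>y\<close>.\<close>

abbreviation Kxy :: "'k::field poly poly ring"
  where "Kxy \<equiv> ring_of_type_algebra"

definition var_x :: "'k::field poly poly"
  where "var_x = [:[:0, 1:]:]"

definition var_y :: "'k::field poly poly"
  where "var_y = [:0, 1:]"

definition monomials :: "'k::field poly poly set"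
  where "monomials = {var_x ^ i * var_y ^ j | i j. True}"

definition monomials_of_degree :: "nat \<Rightarrow> 'k::field poly poly set"
  where "monomials_of_degree d = {var_x ^ i * var_y ^ j | i j. i + j = d}"

definition monomial_ideal :: "'k::field poly poly set \<Rightarrow> bool"
  where "monomial_ideal I \<longleftrightarrow> (\<exists>S \<subseteq> monomials. I = Idl\<^bsub>Kxy\<^esub> S)"

definition equigenerated :: "'k::field poly poly set \<Rightarrow> bool"
  where "equigenerated I \<longleftrightarrow> (\<exists>d. \<exists>S \<subseteq> monomials_of_degree d. I = Idl\<^bsub>Kxy\<^esub> S)"

end

theory Submission
  imports Defs "HOL-Library.Set_Algebras"
begin

text \<open>An equigenerated monomial ideal is generated by the monomials \<open>x\<^sup>i y\<^sup>d\<^sup>-\<^sup>i\<close> with \<open>i\<close> in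
  a set \<open>A\<close> of exponents between \<open>0\<close> and \<open>d\<close>, and its \<open>k\<close>-th power is generated in the same
  way by the \<open>k\<close>-fold sumset \<open>kA\<close> (\<open>homog_ideal_pow\<close>).  Monomials of one degree are linearly
  independent forms of the lowest degree occurring in the ideal, so they form a minimal system
  of generators and \<open>\<mu>(I\<^sup>k) = |kA|\<close> (\<open>min_gens_homog_ideal\<close>).  Height \<open>2\<close> says that neither \<open>x\<close>
  nor \<open>y\<close> divides all generators and that the ideal is proper, that is, \<open>0\<close> and \<open>d\<close> lie in \<open>A\<close>
  and \<open>d > 0\<close> (\<open>height_2_imp_endpoints\<close>).

  What remains is additive combinatorics.  The sumset \<open>(k+1)A\<close> contains \<open>kA\<close> and \<open>kd + A\<close>,
  which meet only in \<open>kd\<close>; each further summand therefore adds at least \<open>|A| - 1\<close> elements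
  (\<open>card_nfold_sumset_add\<close>).  This is the lower bound, and it also shows that equality for some
  \<open>k \<ge> 2\<close> forces \<open>|2A| = 2|A| - 1\<close>.  Then \<open>2A\<close> is exactly the union of \<open>A\<close> and \<open>d + A\<close>, which
  means that \<open>A\<close> modulo \<open>d\<close> is closed under addition.  A finite additively closed set of residues
  is a cyclic group, so \<open>A = {0, a, 2a, \<dots>, ra}\<close> with \<open>d = ra\<close>
  (\<open>small_doubling_imp_progression\<close>), and these are the exponents of \<open>(x\<^sup>a, y\<^sup>a)\<^sup>r\<close>.  For such
  a progression the sumsets are again progressions and equality holds for every \<open>k\<close>.\<close>

section \<open>Sumsets of finite sets of natural numbers\<close>

abbreviation nfold_sumset :: "nat \<Rightarrow> nat set \<Rightarrow> nat set"
  where "nfold_sumset k A \<equiv> (\<Sum>_<k. A)"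

lemma set_plus_subset_atMost:
  fixes A B :: "nat set"
  assumes "B \<subseteq> {..e}" "A \<subseteq> {..d}"
  shows "B + A \<subseteq> {..e + d}"
  using assms by (fastforce simp: set_plus_def intro: add_mono)

lemma nfold_sumset_subset_atMost:
  assumes "A \<subseteq> {..d}"
  shows "nfold_sumset k A \<subseteq> {..k * d}"
proof (induction k)
  case (Suc k)
  then show ?case using set_plus_subset_atMost[OF Suc assms] by (simp add: add.commute)
qed simp

lemma mult_mem_nfold_sumset:
  assumes "d \<in> A"
  shows "k * d \<in> nfold_sumset k A"
proof (induction k)
  case (Suc k)
  then show ?case using set_plus_intro[OF Suc assms] by (simp add: add.commute)
qed simp

text \<open>The two sets share only the point \<open>e\<close>, the maximum of the first and the minimum of the
  second.\<close>

lemma card_Un_translate: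
  fixes A B :: "nat set"
  assumes "A \<subseteq> {..d}" "0 \<in> A" "B \<subseteq> {..e}" "e \<in> B"
  shows "card (B \<union> (+) e ` A) + 1 = card B + card A"
proof -
  have fin: "finite A" "finite B"
    using assms by (auto intro: finite_subset)
  have "B \<inter> (+) e ` A = {e}"
    using assms by force
  moreover have "card ((+) e ` A) = card A"
    by (simp add: card_image)
  ultimately show ?thesis
    using card_Un_Int[of B "(+) e ` A"] fin by simp
qed

lemma card_set_plus_ge:
  fixes A B :: "nat set"
  assumes "A \<subseteq> {..d}" "0 \<in> A" "B \<subseteq> {..e}" "e \<in> B"
  shows "card B + card A \<le> card (B + A) + 1"
proof -
  have "B \<union> (+) e ` A \<subseteq> B + A"
    using assms by (force simp: set_plus_def)
  moreover have "finite (B + A)"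
    by (rule finite_subset[OF set_plus_subset_atMost[OF assms(3,1)]]) simp
  ultimately have "card (B \<union> (+) e ` A) \<le> card (B + A)"
    by (rule card_mono[rotated])
  then show ?thesis
    using card_Un_translate[OF assms] by linarith
qed

text \<open>For \<open>j = 0\<close> this is the lower bound on the size of a sumset.  The version with general \<open>j\<close>
  lets equality at some \<open>k \<ge> 2\<close> be pulled back to the double sumset.\<close>

lemma card_nfold_sumset_add:
  assumes "A \<subseteq> {..d}" "0 \<in> A" "d \<in> A"
  shows "card (nfold_sumset j A) + i * (card A - 1) \<le> card (nfold_sumset (j + i) A)"
proof (induction i)
  case (Suc i)
  have arith: "x + (c - 1 + y) \<le> q" if "x + y \<le> n" "n + c \<le> q + 1" "c > 0" for x y n c q :: nat
    using that by linarith
  have pos: "card A > 0"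
    using finite_subset[OF assms(1)] assms(2) by (auto simp: card_gt_0_iff)
  have step: "card (nfold_sumset (j + i) A) + card A \<le> card (nfold_sumset (j + i) A + A) + 1"
    using card_set_plus_ge[OF assms(1,2) nfold_sumset_subset_atMost[OF assms(1)]
        mult_mem_nfold_sumset[OF assms(3)]] .
  show ?case
    unfolding mult_Suc add_Suc_right sum.lessThan_Suc by (rule arith[OF Suc step pos])
qed simp

text \<open>Translation by the least positive element \<open>a\<close> of \<open>A\<close> maps the residues of \<open>A\<close> modulo \<open>d\<close>
  injectively into themselves, hence onto.  So \<open>a\<close> can be subtracted from any element of \<open>A\<close> that
  is at least \<open>a\<close>, and descending in this way from any element ends at \<open>0\<close>.\<close>

lemma small_doubling_imp_progression:
  fixes A :: "nat set"
  assumes A: "A \<subseteq> {..d}" "0 \<in> A" "d \<in> A" and d: "d > 0"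
    and small: "card (A + A) + 1 \<le> 2 * card A"
  obtains a r where "a > 0" "r > 0" "d = a * r" "A = (*) a ` {..r}"
proof -
  have finA: "finite A"
    using A(1) by (auto intro: finite_subset)
  have "A \<union> (+) d ` A = A + A"
  proof (rule card_seteq)
    show "finite (A + A)"
      by (rule finite_subset[OF set_plus_subset_atMost[OF A(1,1)]]) simp
    show "A \<union> (+) d ` A \<subseteq> A + A"
      using A by (force simp: set_plus_def)
    show "card (A + A) \<le> card (A \<union> (+) d ` A)"
      using card_Un_translate[OF A(1,2) A(1,3)] small by simp
  qed
  then have closed: "u + v \<in> A \<or> (\<exists>w\<in>A. u + v = d + w)" if "u \<in> A" "v \<in> A" for u v
    using set_plus_intro[OF that] by auto
  define a where "a = (LEAST u. u \<in> A \<and> u > 0)"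
  have a: "a \<in> A" "a > 0"
    using LeastI[of "\<lambda>u. u \<in> A \<and> u > 0" d] A(3) d unfolding a_def by auto
  have least: "a \<le> u" if "u \<in> A" "u > 0" for u
    using that unfolding a_def by (simp add: Least_le)
  have "a \<le> d" using least A(3) d by simp
  \<comment> \<open>\<open>A - {d}\<close> is a set of representatives of \<open>A\<close> modulo \<open>d\<close>, because \<open>0\<close> and \<open>d\<close> both lie in \<open>A\<close>.\<close>
  define f where "f u = (u + a) mod d" for u
  have f_cases: "f u = (if u + a < d then u + a else u + a - d)" if "u < d" for u
    using that \<open>a \<le> d\<close> unfolding f_def by (simp add: mod_if)
  have maps: "f ` (A - {d}) \<subseteq> A - {d}"
  proof
    fix b assume "b \<in> f ` (A - {d})"
    then obtain u where u: "u \<in> A" "u \<noteq> d" "b = (u + a) mod d"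
      by (auto simp: f_def)
    have "u < d" using u A(1) by force
    consider "u + a < d" | "u + a = d" | "u + a > d" by linarith
    then show "b \<in> A - {d}"
    proof cases
      case 1
      then show ?thesis using closed[OF u(1) a(1)] u(3) by auto
    next
      case 2
      then show ?thesis using A d u(3) by simp
    next
      case 3
      then have "u + a \<notin> A" using A(1) by auto
      then obtain w where w: "w \<in> A" "u + a = d + w" using closed[OF u(1) a(1)] by blast
      then have "w < d" using \<open>u < d\<close> \<open>a \<le> d\<close> by linarith
      then show ?thesis using w u(3) by simp
    qed
  qed
  have inj: "inj_on f (A - {d})"
  proof (rule inj_onI)
    fix u v assume uv: "u \<in> A - {d}" "v \<in> A - {d}" "f u = f v"
    then have "u < d" "v < d" using A(1) by force+
    then show "u = v"
      using uv(3) by (auto simp: f_cases split: if_splits)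
  qed
  have onto: "f ` (A - {d}) = A - {d}"
    by (rule endo_inj_surj[OF _ maps inj]) (use finA in simp)
  have descend: "b - a \<in> A" if "b \<in> A" "a \<le> b" for b
  proof -
    have "b \<le> d" using that A(1) by auto
    then have "b mod d \<in> A - {d}"
      using that A(2) d by (cases "b = d") auto
    then have "b mod d \<in> f ` (A - {d})"
      by (simp only: onto)
    then obtain u where u: "u \<in> A" "u \<noteq> d" "b mod d = (u + a) mod d"
      by (auto simp: f_def)
    have "u < d" using u A(1) by force
    \<comment> \<open>No wrap-around is possible: it would give \<open>b = u + a - d < a\<close>.  The residue \<open>0\<close>
      stands for \<open>d\<close> here, since \<open>b\<close> is positive.\<close>
    have "b = u + a"
    proof (cases "u + a < d")
      case True
      then show ?thesis using u(3) \<open>b \<le> d\<close> a(2) by (cases "b = d") auto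
    next
      case False
      have "(u + a) mod d = u + a - d"
        using False \<open>u < d\<close> \<open>a \<le> d\<close> by (simp add: mod_if)
      then show ?thesis using u(3) \<open>b \<le> d\<close> that(2) a(2) \<open>u < d\<close> False
        by (cases "b = d") auto
    qed
    then show ?thesis using u by simp
  qed
  have dvd: "a dvd b" if "b \<in> A" for b
    using that
  proof (induction b rule: less_induct)
    case (less b)
    show ?case
    proof (cases "b = 0")
      case False
      then have "a \<le> b" using less.prems least by simp
      then have "a dvd b - a" using less descend a(2) False by simp
      then show ?thesis using \<open>a \<le> b\<close> by (metis dvd_diffD dvd_refl)
    qed simp
  qed
  then obtain r where r: "d = a * r" using A(3) by blast
  have mem: "a * (r - j) \<in> A" if "j \<le> r" for j
    using that
  proof (induction j)
    case 0
    then show ?case using r A(3) by simp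
  next
    case (Suc j)
    have eq: "a * (r - j) = a * (r - Suc j) + a"
      using Suc.prems by (metis Suc_diff_Suc Suc_le_lessD add.commute mult_Suc_right)
    show ?case using descend[OF Suc.IH] Suc.prems eq by simp
  qed
  have "A = (*) a ` {..r}"
  proof (intro equalityI subsetI)
    fix b assume b: "b \<in> A"
    then obtain j where "b = a * j" using dvd by blast
    moreover have "b \<le> d" using b A(1) by auto
    ultimately show "b \<in> (*) a ` {..r}" using r a(2) by simp
  next
    fix b assume "b \<in> (*) a ` {..r}"
    then obtain j where "j \<le> r" "b = a * j" by auto
    then show "b \<in> A" using mem[of "r - j"] by simp
  qed
  moreover have "r > 0" using r d by (cases r) auto
  ultimately show thesis using that a(2) r by blast
qed

lemma nfold_sumset_progression:
  "nfold_sumset k ((*) a ` {..r}) = (*) a ` {..k * r}"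
proof (induction k)
  case (Suc k)
  have "(*) a ` {..k * r} + (*) a ` {..r} = (*) a ` {..k * r + r}"
  proof (intro equalityI subsetI)
    fix b assume "b \<in> (*) a ` {..k * r + r}"
    then obtain j where j: "j \<le> k * r + r" "b = a * j" by auto
    have "b = a * min j (k * r) + a * (j - min j (k * r))"
      using j by (simp add: distrib_left[symmetric])
    moreover have "j - min j (k * r) \<le> r" using j by linarith
    ultimately show "b \<in> (*) a ` {..k * r} + (*) a ` {..r}"
      by (auto simp: set_plus_def)
  next
    fix b assume "b \<in> (*) a ` {..k * r} + (*) a ` {..r}"
    then obtain i j where "i \<le> k * r" "j \<le> r" "b = a * i + a * j"
      by (auto simp: set_plus_def)
    then have "b = a * (i + j)" "i + j \<le> k * r + r" by (auto simp: distrib_left)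
    then show "b \<in> (*) a ` {..k * r + r}" by blast
  qed
  then show ?case using Suc by (simp add: add.commute)
qed simp

section \<open>Products of ideals given by generators\<close>

text \<open>Membership of \<open>r t\<close> in a fixed ideal for all \<open>t\<close> is an ideal condition on \<open>r\<close>, so it
  need only be tested on generators.  Applied to one factor and then to the other, this
  computes products of ideals on generators.\<close>

lemma (in cring) colon_ideal:
  assumes J: "ideal J R" and T: "T \<subseteq> carrier R"
  shows "ideal {r \<in> carrier R. \<forall>t\<in>T. r \<otimes> t \<in> J} R"
proof -
  interpret J: ideal J R by fact
  have T': "t \<in> carrier R" if "t \<in> T" for t using that T by blast
  show ?thesis
  proof (intro idealI ring_axioms subgroup.intro)
    fix r s assume r: "r \<in> {r \<in> carrier R. \<forall>t\<in>T. r \<otimes> t \<in> J}" and s: "s \<in> carrier R"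
    then show "s \<otimes> r \<in> {r \<in> carrier R. \<forall>t\<in>T. r \<otimes> t \<in> J}"
      by (auto simp: T' m_assoc J.I_l_closed)
    then show "r \<otimes> s \<in> {r \<in> carrier R. \<forall>t\<in>T. r \<otimes> t \<in> J}"
      using r s by (simp add: m_comm)
  qed (auto simp: T' l_distr J.a_closed l_minus simp flip: a_inv_def)
qed

lemma (in cring) ideal_prod_genideal:
  assumes S: "S \<subseteq> carrier R" and T: "T \<subseteq> carrier R"
  shows "(Idl S) \<cdot> (Idl T) = Idl (S <#> T)"
proof -
  have idS: "ideal (Idl S) R" and idT: "ideal (Idl T) R"
    using S T by (auto intro: genideal_ideal)
  have ST: "S <#> T \<subseteq> carrier R"
    using S T by (rule set_mult_closed)
  let ?J = "Idl (S <#> T)"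
  have idJ: "ideal ?J R" using ST by (rule genideal_ideal)
  have S_T: "s \<otimes> t \<in> ?J" if "s \<in> S" "t \<in> T" for s t
    using that genideal_self[OF ST] by (auto simp: set_mult_def)
  have "Idl S \<subseteq> {r \<in> carrier R. \<forall>t\<in>T. r \<otimes> t \<in> ?J}"
    using S S_T by (intro genideal_minimal colon_ideal idJ T) blast
  then have IS_T: "r \<otimes> t \<in> ?J" if "r \<in> Idl S" "t \<in> T" for r t
    using that by blast
  have carr: "Idl S \<subseteq> carrier R"
    using idS by (simp add: additive_subgroup.a_subset ideal.axioms(1))
  have "Idl T \<subseteq> {r \<in> carrier R. \<forall>t\<in>Idl S. r \<otimes> t \<in> ?J}"
  proof (rule genideal_minimal[OF colon_ideal[OF idJ carr]], intro subsetI CollectI conjI ballI)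
    fix t r assume t: "t \<in> T" and r: "r \<in> Idl S"
    then have "t \<otimes> r = r \<otimes> t"
      using T carr by (intro m_comm) auto
    then show "t \<otimes> r \<in> ?J" using IS_T r t by simp
  qed (use T in auto)
  then have IS_IT: "r \<otimes> t \<in> ?J" if "r \<in> Idl S" "t \<in> Idl T" for r t
    using that carr m_comm[of r t] by (auto simp: subset_iff)
  show ?thesis
  proof (rule equalityI)
    have "(Idl S) <#> (Idl T) \<subseteq> ?J"
      using IS_IT by (auto simp: set_mult_def)
    then show "(Idl S) \<cdot> (Idl T) \<subseteq> ?J"
      unfolding ideal_prod_eq_genideal[OF idS idT] by (rule genideal_minimal[OF idJ])
    have "S <#> T \<subseteq> (Idl S) \<cdot> (Idl T)"
      using genideal_self[OF S] genideal_self[OF T]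
      by (auto simp: set_mult_def intro!: ideal_prod.prod)
    then show "?J \<subseteq> (Idl S) \<cdot> (Idl T)"
      by (rule genideal_minimal[OF ideal_prod_is_ideal[OF idS idT]])
  qed
qed

section \<open>Equigenerated monomial ideals and sumsets\<close>

interpretation Kxy: cring "Kxy :: 'k::field poly poly ring"
  by (rule cring_from_type_algebra)

lemma Kxy_simps [simp]:
  "carrier Kxy = UNIV"
  "monoid.mult (Kxy :: 'k::field poly poly ring) = (*)"
  "monoid.one (Kxy :: 'k poly poly ring) = 1"
  "ring.add (Kxy :: 'k poly poly ring) = (+)"
  "ring.zero (Kxy :: 'k poly poly ring) = 0"
  by (simp_all add: ring_of_type_algebra_def fun_eq_iff)

lemma Kxy_idealI:
  fixes J :: "'k::field poly poly set"
  assumes "0 \<in> J" "\<And>f g. f \<in> J \<Longrightarrow> g \<in> J \<Longrightarrow> f + g \<in> J" "\<And>f g. f \<in> J \<Longrightarrow> g * f \<in> J"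
  shows "ideal J Kxy"
proof (intro idealI Kxy.ring_axioms subgroup.intro)
  fix f assume f: "f \<in> J"
  have "\<ominus>\<^bsub>Kxy\<^esub> f = - f"
    by (rule Kxy.minus_equality) auto
  then show "inv\<^bsub>add_monoid Kxy\<^esub> f \<in> J"
    using assms(3)[OF f, of "-1"] by (simp add: a_inv_def)
qed (use assms in \<open>auto simp: mult.commute\<close>)

definition homog_mono :: "nat \<Rightarrow> nat \<Rightarrow> 'k::field poly poly"
  where "homog_mono d i = var_x ^ i * var_y ^ (d - i)"

abbreviation homog_ideal :: "nat \<Rightarrow> nat set \<Rightarrow> 'k::field poly poly set"
  where "homog_ideal d A \<equiv> Idl\<^bsub>Kxy\<^esub> (homog_mono d ` A)"

lemma homog_mono_mult:
  assumes "i \<le> d" "j \<le> e"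
  shows "homog_mono d i * homog_mono e j = homog_mono (d + e) (i + j)"
proof -
  have "d + e - (i + j) = (d - i) + (e - j)" using assms by simp
  then show ?thesis by (simp add: homog_mono_def power_add)
qed

lemma homog_ideal_prod:
  assumes "A \<subseteq> {..d}" "B \<subseteq> {..e}"
  shows "ideal_prod Kxy (homog_ideal d A) (homog_ideal e B)
    = (homog_ideal (d + e) (A + B) :: 'k::field poly poly set)"
proof -
  have "homog_mono d ` A <#>\<^bsub>Kxy\<^esub> homog_mono e ` B
    = (homog_mono (d + e) ` (A + B) :: 'k poly poly set)"
    using assms by (force simp: set_mult_def set_plus_def homog_mono_mult subset_iff)
  then show ?thesis
    by (subst Kxy.ideal_prod_genideal) auto
qed

lemma Idl_1: "Idl\<^bsub>Kxy\<^esub> {1} = (UNIV :: 'k::field poly poly set)"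
  using Kxy.genideal_one by simp

lemma homog_ideal_pow:
  assumes "A \<subseteq> {..d}"
  shows "ideal_pow Kxy (homog_ideal d A) k
    = (homog_ideal (k * d) (nfold_sumset k A) :: 'k::field poly poly set)"
proof (induction k)
  case 0
  show ?case
    by (simp add: Idl_1 ideals_set_def homog_mono_def)
next
  case (Suc k)
  then show ?case
    using homog_ideal_prod[OF nfold_sumset_subset_atMost[OF assms] assms, of k]
    by (simp add: ideals_set_def add.commute)
qed

section \<open>Counting generators by forms of lowest degree\<close>

abbreviation coeff_xy :: "'k::field poly poly \<Rightarrow> nat \<Rightarrow> nat \<Rightarrow> 'k"
  where "coeff_xy f i j \<equiv> coeff (coeff f j) i"

lemma var_power_mult_eq_monom:
  "var_x ^ i * var_y ^ j = (monom (monom 1 i) j :: 'k::field poly poly)"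
proof -
  have "var_x ^ i = ([:monom 1 i:] :: 'k poly poly)"
    by (induction i) (simp_all add: var_x_def monom_0 monom_Suc one_pCons mult.commute)
  moreover have "var_y ^ j = (monom 1 j :: 'k poly poly)"
    by (simp add: var_y_def monom_altdef)
  ultimately show ?thesis by (simp add: smult_monom)
qed

lemma coeff_xy_homog_mono:
  assumes "i \<le> d"
  shows "coeff_xy (homog_mono d i) a b = (if a = i \<and> b = d - i then 1 else 0)"
  by (simp add: homog_mono_def var_power_mult_eq_monom)

text \<open>The power \<open>(x, y)\<^sup>d\<close>, described by the vanishing of all coefficients of total degree
  below \<open>d\<close>.\<close>

definition order_ge :: "nat \<Rightarrow> 'k::field poly poly set"
  where "order_ge d = {f. \<forall>i j. i + j < d \<longrightarrow> coeff_xy f i j = 0}"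

text \<open>In total degree at most \<open>d\<close>, a nonconstant term of \<open>g\<close> meets only terms of \<open>f\<close> of degree
  below \<open>d\<close>, which vanish.\<close>

lemma coeff_xy_mult_order_ge:
  assumes f: "f \<in> order_ge d" and ij: "i + j \<le> d"
  shows "coeff_xy (g * f) i j = coeff_xy g 0 0 * coeff_xy f i j"
proof -
  have "coeff_xy (g * f) i j
      = (\<Sum>b\<le>j. \<Sum>a\<le>i. coeff_xy g a b * coeff_xy f (i - a) (j - b))"
    by (simp add: coeff_mult coeff_sum)
  also have "\<dots> = (\<Sum>b\<le>j. \<Sum>a\<le>i. if b = 0 then if a = 0
      then coeff_xy g 0 0 * coeff_xy f i j else 0 else 0)"
  proof (intro sum.cong refl)
    fix a b assume "b \<in> {..j}" "a \<in> {..i}"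
    then have "i - a + (j - b) < d" if "a \<noteq> 0 \<or> b \<noteq> 0"
      using that ij by auto
    then show "coeff_xy g a b * coeff_xy f (i - a) (j - b)
        = (if b = 0 then if a = 0 then coeff_xy g 0 0 * coeff_xy f i j else 0 else 0)"
      using f by (auto simp: order_ge_def)
  qed
  also have "\<dots> = (\<Sum>b\<le>j. if b = 0 then coeff_xy g 0 0 * coeff_xy f i j else 0)"
    by (intro sum.cong refl) simp
  finally show ?thesis by simp
qed

text \<open>The homogeneous component of degree \<open>d\<close>, dehomogenized by \<open>y = 1\<close>: a univariate polynomial
  of degree at most \<open>d\<close> carries the same information.\<close>

definition form_part :: "nat \<Rightarrow> 'k::field poly poly \<Rightarrow> 'k poly"
  where "form_part d f = (\<Sum>i\<le>d. monom (coeff_xy f i (d - i)) i)"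

lemma form_part_add: "form_part d (f + g) = form_part d f + form_part d g"
  by (simp add: form_part_def sum.distrib flip: add_monom)

lemma form_part_mult_order_ge:
  assumes "f \<in> order_ge d"
  shows "form_part d (g * f) = smult (coeff_xy g 0 0) (form_part d f)"
  by (rule poly_eqI) (simp add: form_part_def coeff_sum sum_distrib_left
    coeff_xy_mult_order_ge[OF assms] if_distrib cong: if_cong)

lemma form_part_homog_mono:
  assumes "i \<le> d"
  shows "form_part d (homog_mono d i) = monom 1 i"
proof -
  have "form_part d (homog_mono d i) = (\<Sum>j\<le>d. if j = i then monom 1 i else 0)"
    unfolding form_part_def
    by (intro sum.cong refl) (auto simp: coeff_xy_homog_mono[OF assms])
  then show ?thesis using assms by simp
qed

lemma ideal_order_ge: "ideal (order_ge d) Kxy"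
proof (rule Kxy_idealI)
  fix f g :: "'a poly poly" assume f: "f \<in> order_ge d"
  show "g * f \<in> order_ge d"
    unfolding order_ge_def
  proof (intro CollectI allI impI)
    fix i j assume ij: "i + j < d"
    then show "coeff_xy (g * f) i j = 0"
      using coeff_xy_mult_order_ge[OF f, of i j g] f by (simp add: order_ge_def)
  qed
qed (auto simp: order_ge_def)

interpretation poly_vs: vector_space "smult :: 'k::field \<Rightarrow> 'k poly \<Rightarrow> 'k poly"
  by unfold_locales (simp_all add: smult_add_right smult_add_left)

lemma independent_monoms: "poly_vs.independent ((\<lambda>i. monom 1 i) ` A)"
proof
  assume "poly_vs.dependent ((\<lambda>i. monom (1::'a) i) ` A)"
  then obtain T u v where T: "finite T" "T \<subseteq> (\<lambda>i. monom 1 i) ` A"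
    and v: "v \<in> T" "u v \<noteq> (0::'a)" and sum: "(\<Sum>w\<in>T. smult (u w) w) = 0"
    unfolding poly_vs.dependent_explicit by blast
  obtain i where i: "v = monom 1 i" using T(2) v(1) by blast
  have "coeff (\<Sum>w\<in>T. smult (u w) w) i = (\<Sum>w\<in>T. if w = v then u v else 0)"
    unfolding coeff_sum
  proof (intro sum.cong refl)
    fix w assume "w \<in> T"
    then obtain j where "w = monom 1 j" using T(2) by blast
    then show "coeff (smult (u w) w) i = (if w = v then u v else 0)"
      using i by (auto simp: monom_eq_iff')
  qed
  then show False using sum v T(1) by simp
qed

text \<open>On the ideal, taking the component of degree \<open>d\<close> turns multiplication by a polynomial into
  multiplication by its constant term.  Hence the components of any generators span, over the
  field, the components of all elements of the ideal, among them \<open>card A\<close> independent monomials.\<close>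

lemma card_le_card_generators:
  fixes S :: "'k::field poly poly set"
  assumes A: "A \<subseteq> {..d}" and S: "finite S" and eq: "homog_ideal d A = Idl\<^bsub>Kxy\<^esub> S"
  shows "card A \<le> card S"
proof -
  let ?J = "order_ge d \<inter> {f. form_part d f \<in> poly_vs.span (form_part d ` S)}"
  have "homog_ideal d A \<subseteq> (order_ge d :: 'k poly poly set)"
    using A by (intro Kxy.genideal_minimal ideal_order_ge)
      (auto simp: order_ge_def coeff_xy_homog_mono subset_iff)
  moreover have "S \<subseteq> homog_ideal d A"
    unfolding eq by (rule Kxy.genideal_self) simp
  ultimately have "S \<subseteq> ?J"
    by (auto intro: poly_vs.span_base)
  moreover have "ideal ?J Kxy"
  proof (rule Kxy_idealI)
    have "form_part d (0 :: 'k poly poly) = 0" by (simp add: form_part_def)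
    then show "0 \<in> ?J"
      by (auto simp: order_ge_def poly_vs.span_zero)
  next
    fix f g assume "f \<in> ?J" "g \<in> ?J"
    then show "f + g \<in> ?J"
      by (auto simp: form_part_add order_ge_def intro: poly_vs.span_add)
  next
    fix f g assume "f \<in> ?J"
    then show "g * f \<in> ?J"
      using ideal.I_l_closed[OF ideal_order_ge, of f d g]
      by (auto simp: form_part_mult_order_ge intro: poly_vs.span_scale)
  qed
  ultimately have "homog_ideal d A \<subseteq> ?J"
    unfolding eq by (intro Kxy.genideal_minimal)
  then have "homog_mono d ` A \<subseteq> ?J"
    using Kxy.genideal_self[of "homog_mono d ` A :: 'k poly poly set"] by auto
  then have "(\<lambda>i. monom 1 i) ` A \<subseteq> poly_vs.span (form_part d ` S)"
    using A by (auto simp: form_part_homog_mono subset_iff)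
  then have "card ((\<lambda>i. monom (1::'k) i) ` A) \<le> card (form_part d ` S)"
    using poly_vs.independent_span_bound[OF finite_imageI[OF S] independent_monoms] by blast
  also have "\<dots> \<le> card S" using S by (rule card_image_le)
  finally show ?thesis
    by (simp add: card_image inj_on_def monom_eq_iff')
qed

lemma min_gens_homog_ideal:
  assumes A: "A \<subseteq> {..d}"
  shows "min_gens Kxy (homog_ideal d A :: 'k::field poly poly set) = card A"
  unfolding min_gens_def
proof (rule Least_equality)
  have "inj_on (homog_mono d :: nat \<Rightarrow> 'k poly poly) A"
  proof (rule inj_onI)
    fix i j assume ij: "i \<in> A" "j \<in> A" "homog_mono d i = (homog_mono d j :: 'k poly poly)"
    then have "i \<le> d" "j \<le> d" using A by auto
    then have "monom (1 :: 'k) i = monom 1 j"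
      using ij(3) by (metis form_part_homog_mono)
    then show "i = j" by (simp add: monom_eq_iff')
  qed
  moreover have "finite A" by (rule finite_subset[OF A]) simp
  ultimately show "\<exists>S. finite S \<and> card S = card A \<and> S \<subseteq> carrier Kxy
      \<and> (homog_ideal d A :: 'k poly poly set) = Idl\<^bsub>Kxy\<^esub> S"
    by (intro exI[of _ "homog_mono d ` A"]) (simp add: card_image)
next
  fix n assume "\<exists>S. finite S \<and> card S = n \<and> S \<subseteq> carrier Kxy
      \<and> (homog_ideal d A :: 'k poly poly set) = Idl\<^bsub>Kxy\<^esub> S"
  then show "card A \<le> n" using card_le_card_generators[OF A] by blast
qed

section \<open>The height condition\<close>

text \<open>Let \<open>Q\<close> be a prime strictly inside the multiples of \<open>p\<close>.  It does not contain \<open>p\<close>, so with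
  \<open>p g\<close> it contains \<open>g\<close>, and its elements can be divided by \<open>p\<close> for ever.  The measure \<open>\<delta>\<close> rules
  this out for nonzero elements, so \<open>Q = 0\<close>, and no third prime fits below.\<close>

lemma prime_height_multiples_le_1:
  fixes p :: "'k::field poly poly" and \<delta> :: "'k poly poly \<Rightarrow> nat"
  assumes \<delta>: "\<And>f. f \<noteq> 0 \<Longrightarrow> \<delta> f < \<delta> (p * f)"
  shows "prime_height Kxy {f. p dvd f} \<le> 1"
  unfolding prime_height_def
proof (rule Sup_least, safe)
  fix n C
  assume prime: "\<forall>i\<le>n. primeideal (C i) (Kxy :: 'k poly poly ring)"
    and chain: "\<forall>i<n. C i \<subset> C (Suc i)" and top: "C n = {f. p dvd f}"
  show "enat n \<le> 1"
  proof (rule ccontr)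
    assume "\<not> enat n \<le> 1"
    then have "n > 1" by (simp add: one_enat_def)
    then obtain l where l: "n = Suc (Suc l)"
      using less_iff_Suc_add by auto
    let ?Q = "C (Suc l)"
    interpret Q: primeideal ?Q "Kxy :: 'k poly poly ring" using prime l by simp
    interpret L: primeideal "C l" "Kxy :: 'k poly poly ring" using prime l by simp
    have Q: "C l \<subset> ?Q" "?Q \<subset> {f. p dvd f}"
      using chain l top by (metis lessI less_SucI)+
    have "p \<notin> ?Q"
    proof
      assume "p \<in> ?Q"
      then have "{f. p dvd f} \<subseteq> ?Q"
        using Q.I_r_closed[of p] by (auto elim!: dvdE)
      then show False using Q(2) by blast
    qed
    have "f = 0" if "f \<in> ?Q" for f
      using that
    proof (induction "\<delta> f" arbitrary: f rule: less_induct)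
      case less
      then obtain g where g: "f = p * g" using Q(2) by blast
      then have "g \<in> ?Q" using less.prems Q.I_prime[of p g] \<open>p \<notin> ?Q\<close> by auto
      then show ?case using less.hyps[of g] \<delta>[of g] g by (cases "g = 0") auto
    qed
    then show False using Q(1) L.zero_closed by auto
  qed
qed

lemma ideal_height_le_1_if_common_prime_factor:
  fixes p :: "'k::field poly poly" and \<delta> :: "'k poly poly \<Rightarrow> nat"
  assumes p: "prime_elem p" and S: "\<And>s. s \<in> S \<Longrightarrow> p dvd s"
    and \<delta>: "\<And>f. f \<noteq> 0 \<Longrightarrow> \<delta> f < \<delta> (p * f)"
  shows "ideal_height Kxy (Idl\<^bsub>Kxy\<^esub> S) \<le> 1"
proof -
  have idl: "ideal {f. p dvd f} Kxy"
    by (rule Kxy_idealI) auto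
  have "primeideal {f. p dvd f} Kxy"
  proof (rule primeidealI[OF idl Kxy.cring_axioms])
    show "carrier Kxy \<noteq> {f. p dvd f}"
      using p by (auto simp: prime_elem_def)
  qed (use p in \<open>auto simp: prime_elem_dvd_mult_iff\<close>)
  moreover have "Idl\<^bsub>Kxy\<^esub> S \<subseteq> {f. p dvd f}"
    using S by (intro Kxy.genideal_minimal idl) auto
  ultimately have "ideal_height Kxy (Idl\<^bsub>Kxy\<^esub> S) \<le> prime_height Kxy {f. p dvd f}"
    unfolding ideal_height_def by (intro Inf_lower) blast
  then show ?thesis
    using prime_height_multiples_le_1[where \<delta> = \<delta> and p = p, OF \<delta>] by (rule order_trans)
qed

lemma prime_elem_pCons_0_1: "prime_elem ([:0, 1:] :: 'a::idom poly)"
  by (rule prime_elemI) (auto simp: dvd_iff_poly_eq_0[of 0, simplified] poly_0_coeff_0 coeff_mult)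

lemma prime_elem_var: "prime_elem var_x" "prime_elem var_y"
  unfolding var_x_def var_y_def by (intro lift_prime_elem_poly prime_elem_pCons_0_1)+

lemma height_2_imp_endpoints:
  assumes A: "A \<subseteq> {..d}"
    and height: "ideal_height Kxy (homog_ideal d A :: 'k::field poly poly set) = 2"
  shows "0 \<in> A" "d \<in> A" "d > 0"
proof -
  have no_common: False if "prime_elem p" "\<And>i. i \<in> A \<Longrightarrow> p dvd homog_mono d i"
    "\<And>f. f \<noteq> 0 \<Longrightarrow> \<delta> f < \<delta> (p * f)" for p :: "'k poly poly" and \<delta> :: "'k poly poly \<Rightarrow> nat"
  proof -
    have "ideal_height Kxy (homog_ideal d A :: 'k poly poly set) \<le> 1"
      using that by (intro ideal_height_le_1_if_common_prime_factor[of p _ \<delta>]) auto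
    then show False using height by (simp add: one_enat_def numeral_eq_enat)
  qed
  show A0: "0 \<in> A"
  proof (rule ccontr)
    assume "0 \<notin> A"
    then have "var_x dvd homog_mono d i" if "i \<in> A" for i
      using that unfolding homog_mono_def by (cases i) auto
    \<comment> \<open>Since \<open>y\<close> is the outer variable, the degree in \<open>x\<close> of the leading coefficient counts factors \<open>x\<close>.\<close>
    moreover have "degree (lead_coeff f) < degree (lead_coeff (var_x * f))"
      if "f \<noteq> 0" for f :: "'k poly poly"
    proof -
      have "lead_coeff (var_x * f) = [:0, 1:] * lead_coeff f"
        by (simp only: lead_coeff_mult) (simp add: var_x_def)
      then show ?thesis using that by (simp add: degree_mult_eq)
    qed
    ultimately show False by (rule no_common[OF prime_elem_var(1)])
  qed
  show Ad: "d \<in> A"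
  proof (rule ccontr)
    assume "d \<notin> A"
    then have "var_y dvd homog_mono d i" if "i \<in> A" for i
      using that A unfolding homog_mono_def by (metis atMost_iff diff_is_0_eq dvd_mult
          dvd_power le_antisym not_gr_zero subsetD)
    moreover have "degree f < degree (var_y * f)" if "f \<noteq> 0" for f :: "'k poly poly"
      using that by (simp add: var_y_def)
    ultimately show False by (rule no_common[OF prime_elem_var(2)])
  qed
  show "d > 0"
  proof (rule ccontr)
    assume "\<not> d > 0"
    then have "A = {0}" "d = 0" using A A0 by auto
    then have "homog_ideal d A = (carrier Kxy :: 'k poly poly set)"
      by (simp add: Idl_1 homog_mono_def)
    then have no_prime: "{prime_height Kxy P | P. primeideal P Kxy
        \<and> (homog_ideal d A :: 'k poly poly set) \<subseteq> P} = {}"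
      using primeideal.I_notcarr by fastforce
    then have "ideal_height Kxy (homog_ideal d A :: 'k poly poly set) = \<infinity>"
      unfolding ideal_height_def no_prime by (simp add: top_enat_def)
    then show False using height by (simp add: numeral_eq_enat)
  qed
qed

section \<open>Numbers of generators of powers\<close>

lemma equigenerated_obtains_homog_ideal:
  fixes I :: "'k::field poly poly set"
  assumes "equigenerated I"
  obtains d A where "A \<subseteq> {..d}" "I = homog_ideal d A"
proof -
  obtain d S where S: "S \<subseteq> monomials_of_degree d" "I = Idl\<^bsub>Kxy\<^esub> S"
    using assms unfolding equigenerated_def by blast
  have "S = homog_mono d ` {i. i \<le> d \<and> homog_mono d i \<in> S}"
  proof (intro equalityI subsetI)
    fix s assume s: "s \<in> S"
    then obtain i j where "s = var_x ^ i * var_y ^ j" "i + j = d"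
      using S(1) by (auto simp: monomials_of_degree_def)
    then have "s = homog_mono d i" "i \<le> d" by (auto simp: homog_mono_def)
    then show "s \<in> homog_mono d ` {i. i \<le> d \<and> homog_mono d i \<in> S}" using s by blast
  qed auto
  then show thesis using that[of "{i. i \<le> d \<and> homog_mono d i \<in> S}" d] S(2) by auto
qed

lemma pure_powers_ideal_pow:
  "ideal_pow Kxy (Idl\<^bsub>Kxy\<^esub> {var_x ^ a, var_y ^ a}) r
    = (homog_ideal (r * a) ((*) a ` {..r}) :: 'k::field poly poly set)"
proof -
  have "(*) a ` {..1} = {0, a}"
    by (auto simp: atMost_Suc)
  then have "nfold_sumset r {0, a} = (*) a ` {..r}"
    using nfold_sumset_progression[where k = r and a = a and r = 1] by (simp only: mult_1_right)
  moreover have "homog_mono a ` {0, a} = ({var_x ^ a, var_y ^ a} :: 'k poly poly set)"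
    by (auto simp: homog_mono_def)
  ultimately show ?thesis
    using homog_ideal_pow[of "{0, a}" a r, where 'k = 'k] by simp
qed

theorem corollary3p4:
  fixes I :: "'k::field poly poly set" and m :: nat
  assumes "monomial_ideal I" and "equigenerated I"
    and "min_gens Kxy I = m"
    and "ideal_height Kxy I = 2"
  shows "(\<forall>k\<ge>1. min_gens Kxy (ideal_pow Kxy I k) \<ge> k * (m - 1) + 1) \<and>
    ((\<exists>k\<ge>2. min_gens Kxy (ideal_pow Kxy I k) = k * (m - 1) + 1) \<longleftrightarrow>
     (\<forall>k\<ge>2. min_gens Kxy (ideal_pow Kxy I k) = k * (m - 1) + 1)) \<and>
    ((\<forall>k\<ge>2. min_gens Kxy (ideal_pow Kxy I k) = k * (m - 1) + 1) \<longleftrightarrow>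
     (\<exists>a r :: nat. a > 0 \<and> r > 0 \<and> I = ideal_pow Kxy (Idl\<^bsub>Kxy\<^esub> {var_x ^ a, var_y ^ a}) r))"
proof -
  obtain d A where A: "A \<subseteq> {..d}" and I: "I = homog_ideal d A"
    using equigenerated_obtains_homog_ideal[OF assms(2)] .
  have ends: "0 \<in> A" "d \<in> A" "d > 0"
    using height_2_imp_endpoints[OF A] assms(4) I by auto
  have m: "m = card A"
    using assms(3) I by (simp add: min_gens_homog_ideal[OF A])
  have pow: "min_gens Kxy (ideal_pow Kxy I k) = card (nfold_sumset k A)" for k
    unfolding I homog_ideal_pow[OF A]
    by (rule min_gens_homog_ideal[OF nfold_sumset_subset_atMost[OF A]])
  have lower: "k * (m - 1) + 1 \<le> min_gens Kxy (ideal_pow Kxy I k)" for k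
    using card_nfold_sumset_add[OF A ends(1,2), of 0 k] by (simp add: pow m)
  have some_imp_form: "\<exists>a r. a > 0 \<and> r > 0 \<and> I = ideal_pow Kxy (Idl\<^bsub>Kxy\<^esub> {var_x ^ a, var_y ^ a}) r"
    if k: "k \<ge> 2" "min_gens Kxy (ideal_pow Kxy I k) = k * (m - 1) + 1" for k
  proof -
    have "card (nfold_sumset 2 A) + (k - 2) * (card A - 1) \<le> k * (card A - 1) + 1"
      using card_nfold_sumset_add[OF A ends(1,2), of 2 "k - 2"] k(2)
      by (simp only: pow m le_add_diff_inverse[OF k(1)])
    moreover have "k * (card A - 1) = (k - 2) * (card A - 1) + 2 * (card A - 1)"
      using k(1) by (metis add_mult_distrib le_add_diff_inverse2)
    moreover have "card A > 0"
      using finite_subset[OF A] ends(1) by (auto simp: card_gt_0_iff)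
    moreover have "nfold_sumset 2 A = A + A"
      by (simp add: numeral_2_eq_2)
    ultimately have "card (A + A) + 1 \<le> 2 * card A" by simp
    then obtain a r where ar: "a > 0" "r > 0" "d = a * r" "A = (*) a ` {..r}"
      using small_doubling_imp_progression[OF A ends] by blast
    have "I = ideal_pow Kxy (Idl\<^bsub>Kxy\<^esub> {var_x ^ a, var_y ^ a}) r"
      unfolding I pure_powers_ideal_pow ar(3,4) by (simp only: mult.commute)
    then show ?thesis using ar(1,2) by blast
  qed
  have form_imp_all: "min_gens Kxy (ideal_pow Kxy I k) = k * (m - 1) + 1"
    if "a > 0" "I = ideal_pow Kxy (Idl\<^bsub>Kxy\<^esub> {var_x ^ a, var_y ^ a}) r" for a r k
  proof -
    have I': "I = homog_ideal (r * a) ((*) a ` {..r})"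
      using that(2) by (simp only: pure_powers_ideal_pow)
    have sub: "(*) a ` {..r} \<subseteq> {..r * a}" by (auto simp: mult.commute)
    have card: "card ((*) a ` {..n}) = n + 1" for n
      using that(1) by (simp add: card_image inj_on_def)
    have "m = r + 1"
      using assms(3) min_gens_homog_ideal[OF sub, where 'k = 'k] card by (simp add: I')
    moreover have "min_gens Kxy (ideal_pow Kxy I k) = card (nfold_sumset k ((*) a ` {..r}))"
      unfolding I' homog_ideal_pow[OF sub]
      by (rule min_gens_homog_ideal[OF nfold_sumset_subset_atMost[OF sub]])
    ultimately show ?thesis by (simp only: nfold_sumset_progression card) simp
  qed
  let ?minimal = "\<lambda>k. min_gens Kxy (ideal_pow Kxy I k) = k * (m - 1) + 1"
  let ?form = "\<exists>a r. a > 0 \<and> r > 0 \<and> I = ideal_pow Kxy (Idl\<^bsub>Kxy\<^esub> {var_x ^ a, var_y ^ a}) r"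
  have "\<forall>k. ?form \<longrightarrow> ?minimal k"
    using form_imp_all by (intro allI impI) (elim exE conjE)
  then have "(\<exists>k\<ge>2. ?minimal k) \<longleftrightarrow> (\<forall>k\<ge>2. ?minimal k)" "(\<forall>k\<ge>2. ?minimal k) \<longleftrightarrow> ?form"
    using some_imp_form le_refl[of "2 :: nat"] by blast+
  with lower show ?thesis by blast
qed

end
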